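(* Let $f:\mathbb{R}^n\to\mathbb{R}$ be $\mathcal{C}^1$ and $h:\mathbb{R}^n\to\mathbb{R}^p$ be $\mathcal{C}^2$, and let $F$ denote the vector field of the equality-constrained SPPID dynamics (defined in the context), with gains $k_i^{eq}>0$, $k_p^{eq}\ge0$, $k_d^{eq}>0$. Let $\Pi(x):=I_n-J_h(x)^\top\big(J_h(x)J_h(x)^\top\big)^{-1}J_h(x)$ be the orthogonal projector onto $\ker J_h(x)$, defined wherever $J_h(x)$ has full row rank, and define $$F_\infty(x,\nu):=\begin{bmatrix}-\Pi(x)\nabla f(x)\\ k_i^{eq}h(x)\end{bmatrix}.$$ Then: (i) For every $(x,\nu)\in\mathbb{R}^{n+p}$ at which $J_h(x)$ has full row rank, $F(x,\nu)\to F_\infty(x,\nu)$ as $k_d^{eq}\to\infty$. Moreover, $$\|M(x)^{-1}-\Pi(x)\|\le\frac{\Sigma_{\max}}{k_d^{eq}\,\Sigma_{\min}^2},$$ where $\Sigma_{\max}$ and $\Sigma_{\min}$ are the maximum and minimum eigenvalues of $J_h(x)J_h(x)^\top$. Assume, in addition, that LICQ holds on an open neighborhood of $\mathcal{M}:=\{x\in\mathbb{R}^n: h(x)=0\}$ (i.e., $J_h(x)$ has full row rank there). Then: (ii) The manifold $\mathcal{M}$ is forward invariant under $F_\infty$ (if $x(0)\in\mathcal{M}$ then $x(t)\in\mathcal{M}$ along trajectories of $F_\infty$). (iii) A point $(x^\star,\nu^\star)\in\mathcal{M}\times\mathbb{R}^p$ is an equilibrium of $F_\infty$ if and only if $x^\star$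 satisfies the KKT conditions of $\min f(x)$ s.t. $h(x)=0$, with $\nu^\star\in\mathbb{R}^p$ arbitrary. Moreover, the primal and dual dynamics decouple on $\mathcal{M}$, and at any such equilibrium the associated Lagrange multiplier is uniquely given by $$\lambda^\star=-\big(J_h(x^\star)J_h(x^\star)^\top\big)^{-1}J_h(x^\star)\nabla f(x^\star).$$
   Context: $J_h(x)\in\mathbb{R}^{p\times n}$ is the Jacobian of $h$; $\|\cdot\|$ on matrices is the spectral norm. Set $M(x):=I_n+k_d^{eq}J_h(x)^\top J_h(x)$. The equality-constrained SPPID dynamics with state $(x,\nu)\in\mathbb{R}^{n}\times\mathbb{R}^p$ are $$\dot x=-M(x)^{-1}\big(\nabla f(x)+J_h(x)^\top\nu+k_p^{eq}J_h(x)^\top h(x)\big),\qquad\dot\nu=k_i^{eq}h(x).$$ $x^\star$ satisfies the KKT conditions of $\min f(x)$ s.t. $h(x)=0$ if $h(x^\star)=0$ and there is $\lambda^\star\in\mathbb{R}^p$ (the associated Lagrange multiplier) with $\nabla f(x^\star)+J_h(x^\star)^\top\lambda^\star=0$. "Decouple on $\mathcal{M}$" means that on $\mathcal{M}\times\mathbb{R}^p$ the $x$-component of $F_\infty$ does not depend on $\nu$ and the $\nu$-component vanishes. *)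

theory Defs
  imports "HOL-Analysis.Analysis"
begin

section \<open>Smoothness and gradients\<close>

definition C1_fun :: "('a::real_normed_vector \<Rightarrow> 'b::real_normed_vector) \<Rightarrow> bool" where
  "C1_fun f \<longleftrightarrow>
     (\<exists>f' :: 'a \<Rightarrow> 'a \<Rightarrow>\<^sub>L 'b.
        (\<forall>x. (f has_derivative blinfun_apply (f' x)) (at x)) \<and> continuous_on UNIV f')"

definition C2_fun :: "('a::real_normed_vector \<Rightarrow> 'b::real_normed_vector) \<Rightarrow> bool" where
  "C2_fun f \<longleftrightarrow>
     (\<exists>f' :: 'a \<Rightarrow> 'a \<Rightarrow>\<^sub>L 'b.
        (\<forall>x. (f has_derivative blinfun_apply (f' x)) (at x)) \<and> C1_fun f')"

definition grad :: "('a::real_inner \<Rightarrow> real) \<Rightarrow> 'a \<Rightarrow> 'a" where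
  "grad f x = (THE D. GDERIV f x :> D)"

lemma grad_eq:
  assumes "GDERIV f x :> D"
  shows "grad f x = D"
  unfolding grad_def
proof (rule the_equality)
  show "GDERIV f x :> D" by (fact assms)
next
  fix E assume "GDERIV f x :> E"
  with assms have "(\<lambda>v. v \<bullet> E) = (\<lambda>v. v \<bullet> D)"
    unfolding gderiv_def by (rule has_derivative_unique[rotated])
  then have "(E - D) \<bullet> (E - D) = 0"
    by (metis inner_diff_right right_minus_eq)
  then show "E = D" by simp
qed

section \<open>Matrices\<close>

definition spectral_norm :: "real^'n^'m \<Rightarrow> real" where
  "spectral_norm A = onorm (\<lambda>v. A *v v)"

definition eigenvalues :: "real^'n^'n \<Rightarrow> real set" where
  "eigenvalues A = {c. \<exists>v. v \<noteq> 0 \<and> A *v v = c *\<^sub>R v}"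

definition full_row_rank :: "real^'n^'m \<Rightarrow> bool" where
  "full_row_rank A \<longleftrightarrow> rank A = CARD('m)"

section \<open>Vector fields\<close>

definition equilibrium :: "('a::real_normed_vector \<Rightarrow> 'a) \<Rightarrow> 'a \<Rightarrow> bool" where
  "equilibrium V z \<longleftrightarrow> V z = 0"

definition trajectory_on ::
    "real set \<Rightarrow> ('a::real_normed_vector \<Rightarrow> 'a) \<Rightarrow> (real \<Rightarrow> 'a) \<Rightarrow> bool" where
  "trajectory_on I V z \<longleftrightarrow> (\<forall>t\<in>I. (z has_vector_derivative V (z t)) (at t within I))"

text \<open>The interval may be any \<open>[0, T)\<close>, \<open>[0, T]\<close> or \<open>[0, \<infinity>)\<close>, so that solutions which
  exist only for a finite time are covered.\<close>

definition forward_invariant :: "('a::real_normed_vector \<Rightarrow> 'a) \<Rightarrow> 'a set \<Rightarrow> bool" where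
  "forward_invariant V S \<longleftrightarrow>
     (\<forall>I z. is_interval I \<and> 0 \<in> I \<and> I \<subseteq> {0..} \<and> trajectory_on I V z \<and> z 0 \<in> S
        \<longrightarrow> (\<forall>t\<in>I. z t \<in> S))"

definition decouples_on :: "('a \<times> 'b \<Rightarrow> 'a \<times> 'b::zero) \<Rightarrow> 'a set \<Rightarrow> bool" where
  "decouples_on V S \<longleftrightarrow>
     (\<forall>x\<in>S. \<forall>\<nu> \<nu>'. fst (V (x, \<nu>)) = fst (V (x, \<nu>'))) \<and>
     (\<forall>x\<in>S. \<forall>\<nu>. snd (V (x, \<nu>)) = 0)"

section \<open>The equality-constrained problem\<close>

definition feasible_set :: "(real^'n \<Rightarrow> real^'p) \<Rightarrow> (real^'n) set" where
  "feasible_set h = {x. h x = 0}"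

definition LICQ_at :: "(real^'n \<Rightarrow> real^'p) \<Rightarrow> real^'n \<Rightarrow> bool" where
  "LICQ_at h x \<longleftrightarrow> full_row_rank (jacobian h (at x))"

definition KKT_multiplier ::
    "(real^'n \<Rightarrow> real) \<Rightarrow> (real^'n \<Rightarrow> real^'p) \<Rightarrow> real^'n \<Rightarrow> real^'p \<Rightarrow> bool" where
  "KKT_multiplier f h x lam \<longleftrightarrow>
     h x = 0 \<and> grad f x + transpose (jacobian h (at x)) *v lam = 0"

definition KKT_point :: "(real^'n \<Rightarrow> real) \<Rightarrow> (real^'n \<Rightarrow> real^'p) \<Rightarrow> real^'n \<Rightarrow> bool" where
  "KKT_point f h x \<longleftrightarrow> (\<exists>lam. KKT_multiplier f h x lam)"

section \<open>SPPID dynamics and their limit\<close>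

definition M_mat :: "(real^'n \<Rightarrow> real^'p) \<Rightarrow> real \<Rightarrow> real^'n \<Rightarrow> real^'n^'n" where
  "M_mat h kd x =
     mat 1 + kd *\<^sub>R (transpose (jacobian h (at x)) ** jacobian h (at x))"

definition SPPID_field ::
    "(real^'n \<Rightarrow> real) \<Rightarrow> (real^'n \<Rightarrow> real^'p) \<Rightarrow> real \<Rightarrow> real \<Rightarrow> real \<Rightarrow>
     (real^'n) \<times> (real^'p) \<Rightarrow> (real^'n) \<times> (real^'p)" where
  "SPPID_field f h ki kp kd = (\<lambda>(x, \<nu>).
     (- (matrix_inv (M_mat h kd x) *v
           (grad f x + transpose (jacobian h (at x)) *v \<nu>
             + kp *\<^sub>R (transpose (jacobian h (at x)) *v h x))),
      ki *\<^sub>R h x))"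

text \<open>The total function \<^const>\<open>matrix_inv\<close> is unspecified at singular matrices, so \<open>Pi_proj\<close> and
  \<open>F_inf\<close> are meaningful only at points where the Jacobian has full row rank.\<close>

definition Pi_proj :: "(real^'n \<Rightarrow> real^'p) \<Rightarrow> real^'n \<Rightarrow> real^'n^'n" where
  "Pi_proj h x =
     mat 1 - transpose (jacobian h (at x)) **
       matrix_inv (jacobian h (at x) ** transpose (jacobian h (at x))) **
       jacobian h (at x)"

definition F_inf ::
    "(real^'n \<Rightarrow> real) \<Rightarrow> (real^'n \<Rightarrow> real^'p) \<Rightarrow> real \<Rightarrow>
     (real^'n) \<times> (real^'p) \<Rightarrow> (real^'n) \<times> (real^'p)" where
  "F_inf f h ki = (\<lambda>(x, \<nu>). (- (Pi_proj h x *v grad f x), ki *\<^sub>R h x))"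

text \<open>The inverses above exist where they are needed, and \<open>Pi_proj\<close> is the orthogonal projector onto
  the kernel of the Jacobian.\<close>

lemma invertible_M_mat:
  assumes "kd > 0"
  shows "invertible (M_mat h kd x)"
proof -
  let ?J = "jacobian h (at x)"
  have "v = 0" if "M_mat h kd x *v v = 0" for v
  proof -
    have "M_mat h kd x *v v = v + kd *\<^sub>R (transpose ?J *v (?J *v v))"
      by (simp add: M_mat_def matrix_vector_mult_add_rdistrib matrix_vector_mul_assoc
          scaleR_matrix_vector_assoc)
    then have "(M_mat h kd x *v v) \<bullet> v = v \<bullet> v + kd * ((?J *v v) \<bullet> (?J *v v))"
      by (simp add: inner_add_left dot_lmul_matrix)
    moreover have "kd * ((?J *v v) \<bullet> (?J *v v)) \<ge> 0"
      using assms by simp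
    ultimately have "v \<bullet> v \<le> 0"
      using that by simp
    then show ?thesis by (metis inner_gt_zero_iff not_less)
  qed
  then show ?thesis
    by (metis invertible_left_inverse matrix_left_invertible_ker)
qed

lemma invertible_gram:
  fixes A :: "real^'n^'m"
  assumes "full_row_rank A"
  shows "invertible (A ** transpose A)"
proof -
  have "inj ((*v) (transpose A))"
    using assms full_rank_injective[of "transpose A"]
    by (simp add: full_row_rank_def rank_transpose)
  moreover have "transpose A *v y = 0" if "(A ** transpose A) *v y = 0" for y
  proof -
    have "(transpose A *v y) \<bullet> (transpose A *v y) = y \<bullet> ((A ** transpose A) *v y)"
      by (simp add: dot_lmul_matrix flip: matrix_vector_mul_assoc)
    with that show ?thesis by simp
  qed
  ultimately have "y = 0" if "(A ** transpose A) *v y = 0" for y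
    using that by (metis injD matrix_vector_mult_0_right)
  then show ?thesis
    by (metis invertible_left_inverse matrix_left_invertible_ker)
qed

lemma Pi_proj_orthogonal_projector:
  assumes "full_row_rank (jacobian h (at x))"
  shows "jacobian h (at x) *v (Pi_proj h x *v v) = 0"
    and "jacobian h (at x) *v w = 0 \<Longrightarrow> (v - Pi_proj h x *v v) \<bullet> w = 0"
proof -
  let ?J = "jacobian h (at x)"
  let ?G = "?J ** transpose ?J"
  have Pi: "Pi_proj h x *v v = v - transpose ?J *v (matrix_inv ?G *v (?J *v v))"
    by (simp add: Pi_proj_def matrix_vector_mult_diff_rdistrib matrix_vector_mul_assoc
        matrix_mul_assoc)
  have "?G ** matrix_inv ?G = mat 1"
    using invertible_gram[OF assms] unfolding invertible_def matrix_inv_def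
    by (rule someI2_ex) simp
  then have "?J *v (transpose ?J *v (matrix_inv ?G *v (?J *v v))) = ?J *v v"
    by (metis matrix_vector_mul_assoc matrix_vector_mul_lid)
  then show "?J *v (Pi_proj h x *v v) = 0"
    by (simp add: Pi matrix_vector_mult_diff_distrib)
  show "(v - Pi_proj h x *v v) \<bullet> w = 0" if "?J *v w = 0"
    using that by (simp add: Pi dot_lmul_matrix)
qed

end

theory Submission
  imports Defs
begin

text \<open>Write J for the Jacobian at x, G = J J^T, and m for the least eigenvalue of G. On the
  kernel of J the matrix M is the identity; on the row space, the range of J^T, it is bounded below
  by 1 + kd m. As Pi projects onto the kernel, M^-1 - Pi vanishes there and has norm at most 1 / (kd
  m) on the row space. This tends to 0 as kd grows, and the limit field loses every term in the
  range of J^T because Pi annihilates them. \<open>Min_eigenvalue_gram_row_space\<close> supplies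
  the lower bound and \<open>norm_M_inv_minus_Pi\<close> the resulting estimate. The spectral input
  is a minimiser of the Rayleigh quotient (\<open>minimal_eigenvalue_symmetric\<close>), not a full
  diagonalisation.

  On the feasible set the limiting x-velocity lies in the kernel of J, so h is constant along
  trajectories (\<open>forward_invariant_F_inf\<close>). Moreover Pi grad f = grad f + J^T lam for
  lam = -G^-1 J grad f, so the projected gradient vanishes exactly when x is stationary, and
  invertibility of G leaves no other multiplier (\<open>KKT_multiplier_iff\<close>).\<close>

lemma matrix_inv_mult_cancel:
  fixes A :: "real^'n^'n"
  assumes "invertible A"
  shows "A *v (matrix_inv A *v v) = v" and "matrix_inv A *v (A *v v) = v"
proof -
  have "A ** matrix_inv A = mat 1 \<and> matrix_inv A ** A = mat 1"
    using assms unfolding invertible_def matrix_inv_def by (rule someI2_ex) simp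
  then show "A *v (matrix_inv A *v v) = v" and "matrix_inv A *v (A *v v) = v"
    by (simp_all add: matrix_vector_mul_assoc)
qed

subsection \<open>Extremal eigenvalues of symmetric matrices\<close>

lemma inner_symmetric_matrix:
  fixes A :: "real^'n^'n"
  assumes "transpose A = A"
  shows "(A *v v) \<bullet> w = v \<bullet> (A *v w)"
  by (metis assms dot_lmul_matrix transpose_matrix_vector)

text \<open>Eigenvectors for distinct eigenvalues are orthogonal, hence independent, so there are
  finitely many. \<open>Min\<close> and \<open>Max\<close> of the spectrum are informative only
  because of this.\<close>

lemma finite_eigenvalues_symmetric:
  fixes A :: "real^'n^'n"
  assumes sym: "transpose A = A"
  shows "finite (eigenvalues A)"
proof -
  obtain e where e: "\<And>c. c \<in> eigenvalues A \<Longrightarrow> e c \<noteq> 0 \<and> A *v e c = c *\<^sub>R e c"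
    using bchoice[of "eigenvalues A" "\<lambda>c v. v \<noteq> 0 \<and> A *v v = c *\<^sub>R v"]
    by (auto simp: eigenvalues_def)
  have orth: "e c \<bullet> e d = 0" if "c \<in> eigenvalues A" "d \<in> eigenvalues A" "c \<noteq> d" for c d
    using inner_symmetric_matrix[OF sym, of "e c" "e d"] e[OF that(1)] e[OF that(2)] that(3) by simp
  have inj: "inj_on e (eigenvalues A)"
    by (rule inj_onI) (metis e inner_eq_zero_iff orth)
  have "pairwise orthogonal (e ` eigenvalues A)"
    unfolding pairwise_def orthogonal_def using orth by blast
  moreover have "0 \<notin> e ` eigenvalues A"
    using e by force
  ultimately have "independent (e ` eigenvalues A)"
    by (rule pairwise_orthogonal_independent)
  then show ?thesis
    using inj finite_imageD independent_imp_finite by blast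
qed

text \<open>A zero of a nonnegative form is a minimum, so the gradient 2 A y must vanish there;
  otherwise a small step along -A y makes the form negative.\<close>

lemma quadratic_form_zero_imp_kernel:
  fixes A :: "real^'n^'n"
  assumes sym: "transpose A = A" and psd: "\<And>v. v \<bullet> (A *v v) \<ge> 0" and "y \<bullet> (A *v y) = 0"
  shows "A *v y = 0"
proof (rule ccontr)
  let ?w = "A *v y"
  define a where "a = ?w \<bullet> ?w"
  define b where "b = ?w \<bullet> (A *v ?w)"
  assume "?w \<noteq> 0"
  then have "a > 0" by (simp add: a_def)
  have "b \<ge> 0" using psd by (simp add: b_def)
  have *: "(y - t *\<^sub>R ?w) \<bullet> (A *v (y - t *\<^sub>R ?w)) = t * (t * b - 2 * a)" for t
    using assms(3) inner_symmetric_matrix[OF sym, of y "?w"]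
    by (simp add: a_def b_def matrix_vector_mult_diff_distrib matrix_vector_mult_scaleR
        inner_diff_left inner_diff_right inner_commute algebra_simps)
  \<comment> \<open>Small enough that t b <= a, which makes the factor t b - 2 a negative; the + 1
    covers b = 0.\<close>
  define t where "t = a / (b + 1)"
  have "t > 0" using \<open>a > 0\<close> \<open>b \<ge> 0\<close> by (simp add: t_def)
  moreover have "t * b \<le> a"
    using \<open>a > 0\<close> \<open>b \<ge> 0\<close> by (simp add: t_def field_simps)
  ultimately have "t * (t * b - 2 * a) < 0"
    using \<open>a > 0\<close> by (intro mult_pos_neg) auto
  then show False using psd[of "y - t *\<^sub>R ?w"] * by simp
qed

text \<open>The minimum c of the quadratic form on the unit sphere is an eigenvalue: A - c I is
  positive semidefinite and its form vanishes at the minimiser, which therefore lies in its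
  kernel.\<close>

lemma minimal_eigenvalue_symmetric:
  fixes A :: "real^'n^'n"
  assumes sym: "transpose A = A"
  obtains c where "c \<in> eigenvalues A" and "\<And>v. c * (v \<bullet> v) \<le> v \<bullet> (A *v v)"
proof -
  let ?S = "sphere (0::real^'n) 1"
  obtain b :: "real^'n" where "norm b = 1"
    using vector_choose_size[of 1] by auto
  then have "?S \<noteq> {}" by force
  moreover have "continuous_on ?S (\<lambda>v. v \<bullet> (A *v v))"
    by (intro continuous_intros linear_continuous_on_compose matrix_vector_mul_linear)
  ultimately obtain y where y: "y \<in> ?S" and min: "\<And>v. v \<in> ?S \<Longrightarrow> y \<bullet> (A *v y) \<le> v \<bullet> (A *v v)"
    using continuous_attains_inf[OF compact_sphere] by blast
  define c where "c = y \<bullet> (A *v y)"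
  have yy: "y \<bullet> y = 1" using y by (simp add: dot_square_norm)
  have rayleigh: "c * (v \<bullet> v) \<le> v \<bullet> (A *v v)" for v
  proof (cases "v = 0")
    case False
    then have "c \<le> (v /\<^sub>R norm v) \<bullet> (A *v (v /\<^sub>R norm v))"
      unfolding c_def by (intro min) simp
    also have "\<dots> = v \<bullet> (A *v v) / (norm v)\<^sup>2"
      by (simp add: matrix_vector_mult_scaleR power2_eq_square field_simps)
    finally show ?thesis
      using False by (simp add: dot_square_norm field_simps)
  qed simp
  let ?B = "A - c *\<^sub>R mat 1"
  have B: "?B *v v = A *v v - c *\<^sub>R v" for v
    by (simp add: matrix_vector_mult_diff_rdistrib flip: scaleR_matrix_vector_assoc)
  have "transpose ?B = ?B"
    using sym by (simp add: transpose_def mat_def vec_eq_iff)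
  moreover have "v \<bullet> (?B *v v) \<ge> 0" for v
    using rayleigh[of v] by (simp add: B inner_diff_right)
  moreover have "y \<bullet> (?B *v y) = 0"
    by (simp add: B inner_diff_right yy flip: c_def)
  ultimately have "?B *v y = 0"
    by (rule quadratic_form_zero_imp_kernel)
  moreover have "y \<noteq> 0" using yy by auto
  ultimately have "c \<in> eigenvalues A"
    unfolding eigenvalues_def by (auto simp: B)
  with rayleigh show thesis using that by blast
qed

lemma Min_eigenvalue_rayleigh:
  fixes A :: "real^'n^'n"
  assumes sym: "transpose A = A"
  shows "Min (eigenvalues A) * (v \<bullet> v) \<le> v \<bullet> (A *v v)"
proof -
  obtain c where c: "c \<in> eigenvalues A" "\<And>v. c * (v \<bullet> v) \<le> v \<bullet> (A *v v)"
    using minimal_eigenvalue_symmetric[OF sym] by blast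
  have "Min (eigenvalues A) \<le> c"
    using c(1) finite_eigenvalues_symmetric[OF sym] by simp
  then have "Min (eigenvalues A) * (v \<bullet> v) \<le> c * (v \<bullet> v)"
    by (intro mult_right_mono) simp_all
  with c(2) show ?thesis by (meson order_trans)
qed

lemma transpose_gram: "transpose (A ** transpose A) = A ** transpose (A :: real^'n^'m)"
  by (simp add: matrix_transpose_mul)

text \<open>An eigenpair c, y satisfies c |y|^2 = |A^T y|^2, and full row rank makes the right side
  positive.\<close>

lemma extremal_eigenvalues_gram:
  fixes A :: "real^'n^'m"
  assumes "full_row_rank A"
  shows "0 < Min (eigenvalues (A ** transpose A))"
    and "Min (eigenvalues (A ** transpose A)) \<le> Max (eigenvalues (A ** transpose A))"
proof -
  let ?G = "A ** transpose A"
  have fin: "finite (eigenvalues ?G)"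
    by (rule finite_eigenvalues_symmetric[OF transpose_gram])
  have ne: "eigenvalues ?G \<noteq> {}"
    using minimal_eigenvalue_symmetric[OF transpose_gram] by blast
  have "c > 0" if c: "c \<in> eigenvalues ?G" for c
  proof -
    obtain y where y: "y \<noteq> 0" "?G *v y = c *\<^sub>R y"
      using c by (auto simp: eigenvalues_def)
    have "c * (y \<bullet> y) = y \<bullet> (?G *v y)" by (simp add: y)
    also have "\<dots> = (transpose A *v y) \<bullet> (transpose A *v y)"
      by (simp add: dot_lmul_matrix flip: matrix_vector_mul_assoc)
    finally have *: "c * (y \<bullet> y) = (transpose A *v y) \<bullet> (transpose A *v y)" .
    have "?G *v y \<noteq> 0"
      using matrix_inv_mult_cancel(2)[OF invertible_gram[OF assms], of y] y(1)
      by (metis matrix_vector_mult_0_right)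
    then have "transpose A *v y \<noteq> 0"
      by (metis matrix_vector_mul_assoc matrix_vector_mult_0_right)
    with * have "c * (y \<bullet> y) > 0" by simp
    then show ?thesis using inner_ge_zero[of y] by (simp add: zero_less_mult_iff)
  qed
  then show "0 < Min (eigenvalues ?G)" using fin ne by simp
  show "Min (eigenvalues ?G) \<le> Max (eigenvalues ?G)"
    using fin ne by (meson Max_ge Min_in)
qed

text \<open>The smallest eigenvalue of A A^T also bounds A^T A from below, but only on the row
  space. For u = A^T y both |u|^2 and the Rayleigh bound are expressed through the pairing of y with
  A u.\<close>

lemma Min_eigenvalue_gram_row_space:
  fixes A :: "real^'n^'m"
  assumes "full_row_rank A" and u: "u = transpose A *v y"
  shows "Min (eigenvalues (A ** transpose A)) * (u \<bullet> u) \<le> (A *v u) \<bullet> (A *v u)"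
proof -
  let ?G = "A ** transpose A"
  define m where "m = Min (eigenvalues ?G)"
  have "m > 0" using extremal_eigenvalues_gram(1)[OF assms(1)] by (simp add: m_def)
  have Au: "A *v u = ?G *v y" by (simp only: u matrix_vector_mul_assoc)
  have uu: "u \<bullet> u = y \<bullet> (A *v u)" by (simp add: u dot_lmul_matrix)
  have cs: "y \<bullet> (A *v u) \<le> norm y * norm (A *v u)" by (rule norm_cauchy_schwarz)
  have "m * (y \<bullet> y) \<le> y \<bullet> (A *v u)"
    unfolding Au m_def by (rule Min_eigenvalue_rayleigh[OF transpose_gram])
  \<comment> \<open>Cauchy-Schwarz serves twice: here it gives m |y| <= |A u|, and below it bounds
    |u|^2 by |y| |A u|.\<close>
  with cs have "norm y * (m * norm y) \<le> norm y * norm (A *v u)"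
    by (simp add: dot_square_norm power2_eq_square mult_ac)
  then have "m * norm y \<le> norm (A *v u)"
    by (cases "y = 0") simp_all
  then have "m * norm y * norm (A *v u) \<le> norm (A *v u) * norm (A *v u)"
    by (rule mult_right_mono) simp
  moreover have "m * (u \<bullet> u) \<le> m * (norm y * norm (A *v u))"
    using cs \<open>m > 0\<close> by (simp add: uu)
  ultimately show ?thesis
    by (simp add: m_def dot_square_norm power2_eq_square mult_ac)
qed

subsection \<open>The singular limit\<close>

lemma Pi_proj_vector:
  "Pi_proj h x *v v = v - transpose (jacobian h (at x)) *v
     (matrix_inv (jacobian h (at x) ** transpose (jacobian h (at x))) *v (jacobian h (at x) *v v))"
  by (simp add: Pi_proj_def matrix_vector_mult_diff_rdistrib matrix_vector_mul_assoc
      matrix_mul_assoc)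

lemma Pi_proj_row_space:
  assumes "full_row_rank (jacobian h (at x))"
  shows "Pi_proj h x *v (transpose (jacobian h (at x)) *v y) = 0"
  unfolding Pi_proj_vector matrix_vector_mul_assoc[of "jacobian h (at x)" "transpose (jacobian h (at x))"]
  by (simp only: matrix_inv_mult_cancel(2)[OF invertible_gram[OF assms]] diff_self)

text \<open>Put \<open>w = M\<^sup>-\<^sup>1 v\<close> and let \<open>u = w - \<Pi> w\<close> be its component in the row space of \<open>J\<close>. Since \<open>M\<close> is
  the identity on the kernel of \<open>J\<close>, the vector in question is \<open>u\<close>, and pairing \<open>v = M w\<close> with \<open>u\<close>
  gives \<open>kd * m * |u|\<^sup>2 \<le> v \<bullet> u\<close>. This is sharper than the required bound by the
  factor \<open>\<Sigma>\<^sub>m\<^sub>a\<^sub>x / \<Sigma>\<^sub>m\<^sub>i\<^sub>n\<close>.\<close>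

lemma norm_M_inv_minus_Pi:
  fixes h :: "real^'n \<Rightarrow> real^'p"
  assumes rank: "full_row_rank (jacobian h (at x))" and "kd > 0"
  defines "m \<equiv> Min (eigenvalues (jacobian h (at x) ** transpose (jacobian h (at x))))"
  shows "norm ((matrix_inv (M_mat h kd x) - Pi_proj h x) *v v) \<le> norm v / (kd * m)"
proof -
  let ?J = "jacobian h (at x)"
  let ?P = "Pi_proj h x"
  have "m > 0" using extremal_eigenvalues_gram(1)[OF rank] by (simp add: m_def)
  define w where "w = matrix_inv (M_mat h kd x) *v v"
  have "M_mat h kd x *v w = v"
    unfolding w_def by (rule matrix_inv_mult_cancel(1)[OF invertible_M_mat[OF \<open>kd > 0\<close>]])
  then have v: "v = w + kd *\<^sub>R (transpose ?J *v (?J *v w))"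
    by (simp add: M_mat_def matrix_vector_mult_add_rdistrib matrix_vector_mul_assoc
        scaleR_matrix_vector_assoc)
  \<comment> \<open>v and w differ by an element of the row space, which Pi annihilates.\<close>
  have "?P *v v = ?P *v w"
    using Pi_proj_row_space[OF rank]
    by (simp add: v matrix_vector_right_distrib matrix_vector_mult_scaleR)
  then have diff: "(matrix_inv (M_mat h kd x) - ?P) *v v = w - ?P *v w"
    by (simp add: matrix_vector_mult_diff_rdistrib w_def)
  define u where "u = w - ?P *v w"
  have Ju: "?J *v u = ?J *v w"
    using Pi_proj_orthogonal_projector(1)[OF rank]
    by (simp add: u_def matrix_vector_mult_diff_distrib)
  have "(w - ?P *v w) \<bullet> (?P *v w) = 0"
    using Pi_proj_orthogonal_projector[OF rank] by blast
  then have uu: "w \<bullet> u = u \<bullet> u"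
    by (simp add: u_def inner_diff_left inner_diff_right inner_commute)
  have vu: "v \<bullet> u = u \<bullet> u + kd * ((?J *v u) \<bullet> (?J *v u))"
    by (simp add: v inner_add_left uu dot_lmul_matrix Ju)
  have "m * (u \<bullet> u) \<le> (?J *v u) \<bullet> (?J *v u)"
    unfolding m_def
    by (rule Min_eigenvalue_gram_row_space[OF rank]) (simp only: u_def Pi_proj_vector diff_diff_eq2
        add_diff_cancel_left')
  then have "kd * (m * (u \<bullet> u)) \<le> kd * ((?J *v u) \<bullet> (?J *v u))"
    using \<open>kd > 0\<close> by simp
  also have "\<dots> \<le> v \<bullet> u" by (simp add: vu)
  also have "\<dots> \<le> norm v * norm u" by (rule norm_cauchy_schwarz)
  finally have "norm u * (norm u * (kd * m)) \<le> norm u * norm v"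
    by (simp add: dot_square_norm power2_eq_square mult_ac)
  then have "norm u * (kd * m) \<le> norm v"
    by (cases "u = 0") simp_all
  then show ?thesis
    using \<open>m > 0\<close> \<open>kd > 0\<close> by (simp add: diff u_def pos_le_divide_eq)
qed

lemma SPPID_field_tendsto_F_inf:
  fixes h :: "real^'n \<Rightarrow> real^'p"
  assumes rank: "full_row_rank (jacobian h (at x))"
  shows "((\<lambda>kd. SPPID_field f h ki kp kd (x, \<nu>)) \<longlongrightarrow> F_inf f h ki (x, \<nu>)) at_top"
proof -
  let ?J = "jacobian h (at x)"
  define v where "v = grad f x + transpose ?J *v \<nu> + kp *\<^sub>R (transpose ?J *v h x)"
  define m where "m = Min (eigenvalues (?J ** transpose ?J))"
  have m: "m > 0" using extremal_eigenvalues_gram(1)[OF rank] by (simp add: m_def)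
  \<comment> \<open>This is where the dual variable and the proportional term drop out of the
    limit.\<close>
  have Piv: "Pi_proj h x *v v = Pi_proj h x *v grad f x"
    using Pi_proj_row_space[OF rank]
    by (simp add: v_def matrix_vector_right_distrib matrix_vector_mult_scaleR)
  have "((\<lambda>kd. norm v / m * inverse kd) \<longlongrightarrow> norm v / m * 0) at_top"
    by (intro tendsto_intros tendsto_inverse_0_at_top filterlim_ident)
  then have lim: "((\<lambda>kd. norm v / (kd * m)) \<longlongrightarrow> 0) at_top"
    by (simp add: field_simps)
  have "((\<lambda>kd. (matrix_inv (M_mat h kd x) - Pi_proj h x) *v v) \<longlongrightarrow> 0) at_top"
  proof (rule Lim_null_comparison[OF _ lim])
    show "\<forall>\<^sub>F kd in at_top. norm ((matrix_inv (M_mat h kd x) - Pi_proj h x) *v v) \<le> norm v / (kd * m)"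
      using eventually_gt_at_top[of 0]
      by eventually_elim (simp add: m_def norm_M_inv_minus_Pi[OF rank])
  qed
  then have "((\<lambda>kd. matrix_inv (M_mat h kd x) *v v) \<longlongrightarrow> Pi_proj h x *v grad f x) at_top"
    by (simp add: matrix_vector_mult_diff_rdistrib Piv LIM_zero_iff)
  then show ?thesis
    unfolding SPPID_field_def F_inf_def v_def by (simp add: tendsto_Pair tendsto_minus)
qed

lemma spectral_norm_M_inv_minus_Pi:
  fixes h :: "real^'n \<Rightarrow> real^'p"
  assumes rank: "full_row_rank (jacobian h (at x))" and "kd > 0"
  defines "G \<equiv> jacobian h (at x) ** transpose (jacobian h (at x))"
  shows "spectral_norm (matrix_inv (M_mat h kd x) - Pi_proj h x)
    \<le> Max (eigenvalues G) / (kd * (Min (eigenvalues G))\<^sup>2)"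
proof -
  define m where "m = Min (eigenvalues G)"
  have m: "0 < m" "m \<le> Max (eigenvalues G)"
    using extremal_eigenvalues_gram[OF rank] by (simp_all add: m_def G_def)
  have "spectral_norm (matrix_inv (M_mat h kd x) - Pi_proj h x) \<le> 1 / (kd * m)"
    unfolding spectral_norm_def
    using norm_M_inv_minus_Pi[OF rank \<open>kd > 0\<close>] m \<open>kd > 0\<close>
    by (intro onorm_bound) (simp_all add: m_def G_def)
  \<comment> \<open>Expanding the fraction by m brings the sharper bound to the required form, and m
    is then enlarged to the maximal eigenvalue.\<close>
  also have "\<dots> = m / (kd * m\<^sup>2)"
    using m by (simp add: power2_eq_square)
  also have "\<dots> \<le> Max (eigenvalues G) / (kd * m\<^sup>2)"
    using m \<open>kd > 0\<close> by (intro divide_right_mono) simp_all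
  finally show ?thesis by (simp add: m_def)
qed

subsection \<open>The limiting dynamics on the feasible set\<close>

lemma C2_fun_has_derivative_jacobian:
  fixes h :: "real^'n \<Rightarrow> real^'p"
  assumes "C2_fun h"
  shows "(h has_derivative (\<lambda>v. jacobian h (at x) *v v)) (at x)"
  using assms unfolding C2_fun_def jacobian_works[symmetric] differentiable_def by blast

text \<open>Near a feasible point the Jacobian has full row rank and annihilates the \<open>x\<close>-velocity, so
  \<open>h\<close> is locally constant along a trajectory. Hence the set of times at which the trajectory is
  feasible is both closed and open in the time interval.\<close>

lemma forward_invariant_F_inf:
  fixes h :: "real^'n \<Rightarrow> real^'p"
  assumes C2: "C2_fun h"
    and U: "open U" "feasible_set h \<subseteq> U" "\<And>x. x \<in> U \<Longrightarrow> LICQ_at h x"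
  shows "forward_invariant (F_inf f h ki) (feasible_set h \<times> UNIV)"
  unfolding forward_invariant_def
proof (intro allI impI, elim conjE)
  fix I :: "real set" and z :: "real \<Rightarrow> (real^'n) \<times> (real^'p)"
  assume I: "is_interval I" "0 \<in> I" and traj: "trajectory_on I (F_inf f h ki) z"
    and z0: "z 0 \<in> feasible_set h \<times> UNIV"
  define x where "x = (\<lambda>t. fst (z t))"
  have dx: "(x has_vector_derivative - (Pi_proj h (x t) *v grad f (x t))) (at t within I)"
    if "t \<in> I" for t
  proof -
    have "(z has_vector_derivative F_inf f h ki (z t)) (at t within I)"
      using traj that by (simp add: trajectory_on_def)
    from bounded_linear.has_vector_derivative[OF bounded_linear_fst this]
    show ?thesis by (simp add: x_def F_inf_def case_prod_beta)
  qed
  have cx: "continuous_on I x"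
    using dx has_vector_derivative_continuous continuous_on_eq_continuous_within by blast
  have dh: "((\<lambda>t. h (x t)) has_vector_derivative 0) (at t within I)" if "t \<in> I" "x t \<in> U" for t
  proof -
    have "((h \<circ> x) has_vector_derivative
        jacobian h (at (x t)) *v (- (Pi_proj h (x t) *v grad f (x t)))) (at t within I)"
      by (rule vector_derivative_diff_chain_within[OF dx[OF that(1)]
            has_derivative_at_withinI[OF C2_fun_has_derivative_jacobian[OF C2]]])
    moreover have "full_row_rank (jacobian h (at (x t)))"
      using U(3)[OF that(2)] by (simp add: LICQ_at_def)
    ultimately show ?thesis
      by (simp add: o_def linear_neg[OF matrix_vector_mul_linear] Pi_proj_orthogonal_projector(1))
  qed
  define S where "S = {t \<in> I. h (x t) = 0}"
  have "continuous_on UNIV h"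
    using C2_fun_has_derivative_jacobian[OF C2] has_derivative_continuous
    by (metis continuous_at_imp_continuous_on)
  then have "continuous_on I (\<lambda>t. h (x t))"
    using cx by (rule continuous_on_compose2) simp
  then have "closedin (top_of_set I) S"
    unfolding S_def by (rule continuous_closedin_preimage_constant)
  moreover have "openin (top_of_set I) S"
    unfolding openin_contains_ball
  proof (intro conjI ballI)
    show "S \<subseteq> I" by (auto simp: S_def)
    fix t assume "t \<in> S"
    then have t: "t \<in> I" "h (x t) = 0" by (auto simp: S_def)
    have "openin (top_of_set I) (I \<inter> x -` U)"
      using cx U(1) by (rule continuous_openin_preimage_gen)
    moreover have "t \<in> I \<inter> x -` U"
      using t U(2) by (auto simp: feasible_set_def)
    ultimately obtain e where e: "e > 0" "ball t e \<inter> I \<subseteq> I \<inter> x -` U"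
      by (meson openin_contains_ball)
    \<comment> \<open>Convexity turns a vanishing derivative into constancy; it also covers times at
      an endpoint of \<open>I\<close>, where only one-sided neighbourhoods are available.\<close>
    have conv: "convex (ball t e \<inter> I)"
      using I(1) by (simp add: convex_Int is_interval_convex)
    have "h (x s) = 0" if "s \<in> ball t e \<inter> I" for s
    proof -
      have "((\<lambda>t. h (x t)) has_derivative (\<lambda>_. 0)) (at r within ball t e \<inter> I)"
        if "r \<in> ball t e \<inter> I" for r
      proof -
        have "r \<in> I" "x r \<in> U" using that e(2) by auto
        then have "((\<lambda>t. h (x t)) has_derivative (\<lambda>_. 0)) (at r within I)"
          using dh by (simp add: has_vector_derivative_def)
        then show ?thesis by (rule has_derivative_subset) simp
      qed
      from has_derivative_zero_constant[OF conv this] obtain c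
        where "\<And>r. r \<in> ball t e \<inter> I \<Longrightarrow> h (x r) = c" by blast
      then show ?thesis using t e(1) that by (metis IntI centre_in_ball)
    qed
    then show "\<exists>e>0. ball t e \<inter> I \<subseteq> S"
      using e(1) by (auto simp: S_def)
  qed
  moreover have "connected I" using I(1) by (rule is_interval_connected)
  moreover have "0 \<in> S" using z0 I(2) by (auto simp: S_def x_def feasible_set_def)
  ultimately have "S = I" by (metis connected_clopen empty_iff)
  then show "\<forall>t\<in>I. z t \<in> feasible_set h \<times> UNIV"
    by (auto simp: S_def x_def feasible_set_def mem_Times_iff)
qed

text \<open>Applying J to the stationarity equation gives J grad f = -G lam, which determines lam.
  Substituted back, the left side of that equation is exactly Pi grad f. Equilibria, KKT points and
  the multiplier formula are all read off from this.\<close>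

lemma KKT_multiplier_iff:
  fixes h :: "real^'n \<Rightarrow> real^'p"
  assumes rank: "full_row_rank (jacobian h (at x))"
  shows "KKT_multiplier f h x lam \<longleftrightarrow>
    lam = - (matrix_inv (jacobian h (at x) ** transpose (jacobian h (at x)))
      *v (jacobian h (at x) *v grad f x)) \<and> h x = 0 \<and> Pi_proj h x *v grad f x = 0"
proof -
  let ?J = "jacobian h (at x)"
  let ?G = "?J ** transpose ?J"
  let ?lam = "- (matrix_inv ?G *v (?J *v grad f x))"
  note neg = linear_neg[OF matrix_vector_mul_linear]
  have Pi: "Pi_proj h x *v grad f x = grad f x + transpose ?J *v ?lam"
    by (simp only: Pi_proj_vector neg diff_conv_add_uminus)
  have "lam = ?lam" if "grad f x + transpose ?J *v lam = 0"
  proof -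
    have "grad f x = - (transpose ?J *v lam)"
      using that by (rule eq_neg_iff_add_eq_0[THEN iffD2])
    then have "?J *v grad f x = - (?G *v lam)"
      by (simp only: neg matrix_vector_mul_assoc)
    then show ?thesis
      by (simp only: neg minus_minus matrix_inv_mult_cancel(2)[OF invertible_gram[OF rank]])
  qed
  then show ?thesis
    unfolding KKT_multiplier_def Pi by auto
qed

theorem lemma4p2:
  fixes f :: "real^'n \<Rightarrow> real"
    and h :: "real^'n \<Rightarrow> real^'p"
    and ki kp :: real
  assumes "C1_fun f" and "C2_fun h" and "ki > 0" and "kp \<ge> 0"
  shows
    "(\<forall>x \<nu>. full_row_rank (jacobian h (at x)) \<longrightarrow>
        ((\<lambda>kd. SPPID_field f h ki kp kd (x, \<nu>)) \<longlongrightarrow> F_inf f h ki (x, \<nu>)) at_top)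
     \<and>
     (\<forall>x kd. full_row_rank (jacobian h (at x)) \<and> kd > 0 \<longrightarrow>
        spectral_norm (matrix_inv (M_mat h kd x) - Pi_proj h x)
          \<le> Max (eigenvalues (jacobian h (at x) ** transpose (jacobian h (at x))))
             / (kd * (Min (eigenvalues (jacobian h (at x) ** transpose (jacobian h (at x)))))\<^sup>2))
     \<and>
     ((\<exists>U. open U \<and> feasible_set h \<subseteq> U \<and> (\<forall>x\<in>U. LICQ_at h x)) \<longrightarrow>
        forward_invariant (F_inf f h ki) (feasible_set h \<times> UNIV)
        \<and>
        (\<forall>x\<in>feasible_set h. \<forall>\<nu>. equilibrium (F_inf f h ki) (x, \<nu>) \<longleftrightarrow> KKT_point f h x)
        \<and>
        decouples_on (F_inf f h ki) (feasible_set h)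
        \<and>
        (\<forall>x\<in>feasible_set h. \<forall>\<nu>. equilibrium (F_inf f h ki) (x, \<nu>) \<longrightarrow>
           (\<forall>lam. KKT_multiplier f h x lam \<longleftrightarrow>
              lam = - (matrix_inv (jacobian h (at x) ** transpose (jacobian h (at x)))
                         *v (jacobian h (at x) *v grad f x)))))"
proof (intro conjI allI impI)
  show "((\<lambda>kd. SPPID_field f h ki kp kd (x, \<nu>)) \<longlongrightarrow> F_inf f h ki (x, \<nu>)) at_top"
    if "full_row_rank (jacobian h (at x))" for x \<nu>
    using that by (rule SPPID_field_tendsto_F_inf)
next
  fix x and kd :: real
  assume "full_row_rank (jacobian h (at x)) \<and> kd > 0"
  then show "spectral_norm (matrix_inv (M_mat h kd x) - Pi_proj h x)
      \<le> Max (eigenvalues (jacobian h (at x) ** transpose (jacobian h (at x))))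
         / (kd * (Min (eigenvalues (jacobian h (at x) ** transpose (jacobian h (at x)))))\<^sup>2)"
    by (simp add: spectral_norm_M_inv_minus_Pi)
next
  assume "\<exists>U. open U \<and> feasible_set h \<subseteq> U \<and> (\<forall>x\<in>U. LICQ_at h x)"
  then obtain U where U: "open U" "feasible_set h \<subseteq> U" "\<And>x. x \<in> U \<Longrightarrow> LICQ_at h x" by blast
  have rank: "full_row_rank (jacobian h (at x))" if "x \<in> feasible_set h" for x
    using that U by (auto simp: LICQ_at_def)
  have equil: "equilibrium (F_inf f h ki) (x, \<nu>) \<longleftrightarrow> Pi_proj h x *v grad f x = 0"
    if "x \<in> feasible_set h" for x \<nu>
    using that by (simp add: equilibrium_def F_inf_def feasible_set_def zero_prod_def)
  have multiplier: "KKT_multiplier f h x lam \<longleftrightarrow> lam = - (matrix_inv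
      (jacobian h (at x) ** transpose (jacobian h (at x))) *v (jacobian h (at x) *v grad f x)) \<and> Pi_proj h x *v grad f x = 0"
    if "x \<in> feasible_set h" for x lam
    using KKT_multiplier_iff[OF rank[OF that]] that by (simp add: feasible_set_def)
  show "forward_invariant (F_inf f h ki) (feasible_set h \<times> UNIV)"
    using assms(2) U by (rule forward_invariant_F_inf)
  show "\<forall>x\<in>feasible_set h. \<forall>\<nu>. equilibrium (F_inf f h ki) (x, \<nu>) \<longleftrightarrow> KKT_point f h x"
    unfolding KKT_point_def using equil multiplier by blast
  show "decouples_on (F_inf f h ki) (feasible_set h)"
    by (simp add: decouples_on_def F_inf_def feasible_set_def)
  show "\<forall>x\<in>feasible_set h. \<forall>\<nu>. equilibrium (F_inf f h ki) (x, \<nu>) \<longrightarrow>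
      (\<forall>lam. KKT_multiplier f h x lam \<longleftrightarrow>
         lam = - (matrix_inv (jacobian h (at x) ** transpose (jacobian h (at x)))
                    *v (jacobian h (at x) *v grad f x)))"
    using equil multiplier by blast
qed

end
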